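(* In the setting fixed in the context, suppose that $$\int_{t_0}^{+\infty}\beta(t)\epsilon(t)\,dt<+\infty,\qquad \dot\beta(t)\le\frac1\delta\beta(t)\ \text{ for all } t\ge t_0,\qquad \frac1\delta<\gamma .$$ Let $(x,y,\lambda):[t_0,+\infty)\to\mathcal{X}\times\mathcal{Y}\times\mathcal{Z}$ be a solution of the dynamical system (DS). Then, for any $(x^*,y^*,\lambda^* )\in\Omega$, the trajectory $\{(x(t),y(t),\lambda(t))\}_{t\ge t_0}$ is bounded and the following hold. (i) As $t\to+\infty$: $$\mathcal{L}(x(t),y(t),\lambda^* )-\mathcal{L}(x^*,y^*,\lambda^* )=\mathcal{O}\Big(\frac1{\beta(t)}\Big),$$ $$|\varPhi(x(t),y(t))-\varPhi(x^*,y^* )|=\mathcal{O}\Big(\frac1{\sqrt{\beta(t)}}\Big),\qquad \|Ax(t)+By(t)-b\|=\mathcal{O}\Big(\frac1{\sqrt{\beta(t)}}\Big),$$ $$\|\nabla f(x(t))-\nabla f(x^* )\|=\mathcal{O}\Big(\frac1{\sqrt{\beta(t)}}\Big),\qquad \|\nabla g(y(t))-\nabla g(y^* )\|=\mathcal{O}\Big(\frac1{\sqrt{\beta(t)}}\Big).$$ (ii) $$\int_{t_0}^{+\infty}\frac{\delta\gamma-1}{\delta}\big(\|\dot x(t)\|^2+\|\dot y(t)\|^2\big)dt<+\infty,$$ $$\int_{t_0}^{+\infty}\Big(\frac{\beta(t)}{\delta}-\dot\beta(t)\Big)\big(\mathcal{L}(x(t),y(t),\lambda^* )-\mathcal{L}(x^*,y^*,\lambda^*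 )\big)dt<+\infty,$$ $$\int_{t_0}^{+\infty}\frac{\beta(t)\epsilon(t)}{2\delta}\big(\|x(t)-x^*\|^2+\|y(t)-y^*\|^2\big)dt<+\infty,$$ $$\int_{t_0}^{+\infty}\beta(t)\|Ax(t)+By(t)-b\|^2dt<+\infty.$$
   Context: Let $\mathcal{X},\mathcal{Y},\mathcal{Z}$ be real Hilbert spaces, $A:\mathcal{X}\to\mathcal{Z}$ and $B:\mathcal{Y}\to\mathcal{Z}$ continuous linear operators with adjoints $A^\top,B^\top$, and $b\in\mathcal{Z}$. Let $f:\mathcal{X}\to\mathbb{R}$ and $g:\mathcal{Y}\to\mathbb{R}$ be continuously differentiable convex functions, with $\nabla f$ $l_1$-Lipschitz continuous ($l_1>0$) and $\nabla g$ $l_2$-Lipschitz continuous ($l_2>0$). Put $\varPhi(x,y):=f(x)+g(y)$ and consider the problem of minimizing $\varPhi(x,y)$ over $(x,y)\in\mathcal{X}\times\mathcal{Y}$ subject to $Ax+By=b$. The augmented Lagrangian is $$\mathcal{L}(x,y,\lambda)=f(x)+g(y)+\langle\lambda,Ax+By-b\rangle+\tfrac12\|Ax+By-b\|^2 .$$ $\Omega$ denotes its set of saddle points: $(x^*,y^*,\lambda^* )\in\Omega$ iff $\mathcal{L}(x^*,y^*,\lambda)\le\mathcal{L}(x^*,y^*,\lambda^* )\le\mathcal{L}(x,y,\lambda^* )$ for all $(x,y,\lambda)\in\mathcal{X}\times\mathcal{Y}\times\mathcal{Z}$; equivalently $-A^\top\lambda^*=\nabla f(x^* )$, $-B^\top\lambda^*=\nabla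 g(y^* )$, $Ax^*+By^*=b$. It is assumed that $\Omega\neq\emptyset$. Let $t_0>0$, $\gamma>0$, $\delta>0$ be constants; $\beta:[t_0,+\infty)\to(0,+\infty)$ is non-decreasing and continuously differentiable; $\epsilon:[t_0,+\infty)\to[0,+\infty)$ is non-increasing and continuously differentiable with $\lim_{t\to+\infty}\epsilon(t)=0$. The dynamical system (DS) is, for $t\ge t_0$, $$\begin{cases}\ddot{x}(t)+\gamma\dot{x}(t)+\beta(t)\big(\nabla f(x(t))+A^\top\lambda(t)+A^\top(Ax(t)+By(t)-b)+\epsilon(t)x(t)\big)=0,\\ \ddot{y}(t)+\gamma\dot{y}(t)+\beta(t)\big(\nabla g(y(t))+B^\top\lambda(t)+B^\top(Ax(t)+By(t)-b)+\epsilon(t)y(t)\big)=0,\\ \dot{\lambda}(t)-\beta(t)\big(A(x(t)+\delta\dot{x}(t))+B(y(t)+\delta\dot{y}(t))-b\big)=0,\end{cases}$$ and a solution is a triple $(x,y,\lambda)$ with $x,y$ twice differentiable and $\lambda$ differentiable satisfying these equations for all $t\ge t_0$. *)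

theory Defs
  imports "HOL-Analysis.Analysis" "HOL-Library.Landau_Symbols"
begin

(* Hilbert spaces are types of sort {real_inner, complete_space}.  The library's "adjoint" is a
   choice from the maps T with "inner (A x) z = inner x (T z)"; for a bounded linear map on a
   Hilbert space exactly one such T exists (Riesz). *)

definition objective :: "('x \<Rightarrow> real) \<Rightarrow> ('y \<Rightarrow> real) \<Rightarrow> 'x \<Rightarrow> 'y \<Rightarrow> real" where
  "objective f g x y = f x + g y"

definition aug_lagrangian ::
  "('x \<Rightarrow> real) \<Rightarrow> ('y \<Rightarrow> real) \<Rightarrow> ('x \<Rightarrow> 'z::real_inner) \<Rightarrow> ('y \<Rightarrow> 'z) \<Rightarrow> 'z
    \<Rightarrow> 'x \<Rightarrow> 'y \<Rightarrow> 'z \<Rightarrow> real" where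
  "aug_lagrangian f g A B b x y l =
     f x + g y + l \<bullet> (A x + B y - b) + 1 / 2 * (norm (A x + B y - b))\<^sup>2"

definition saddle_points ::
  "('x \<Rightarrow> real) \<Rightarrow> ('y \<Rightarrow> real) \<Rightarrow> ('x \<Rightarrow> 'z::real_inner) \<Rightarrow> ('y \<Rightarrow> 'z) \<Rightarrow> 'z
    \<Rightarrow> ('x \<times> 'y \<times> 'z) set" where
  "saddle_points f g A B b = {(xs, ys, ls). \<forall>x y l.
     aug_lagrangian f g A B b xs ys l \<le> aug_lagrangian f g A B b xs ys ls \<and>
     aug_lagrangian f g A B b xs ys ls \<le> aug_lagrangian f g A B b x y ls}"

end

theory Submission
  imports Defs
begin

text \<open>
  Write p = (x, y), with K p = Ax + By and \<Phi> p = f x + g y, so that the system becomes a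
  one-block flow. Let gap denote the Lagrangian gap L(p, ls) - L(ps, ls).
  Along a trajectory consider
  E = \<beta> (gap p + \<epsilon>/2 |p|^2) + 1/2 |(p - ps)/\<delta> + p'|^2 + (\<gamma> - 1/\<delta>)/(2 \<delta>) |p - ps|^2
  + 1/(2 \<delta>) |l - ls|^2.
  The coefficients are chosen such that the inner products of p - ps and p' with l - ls, and that of p - ps
  with p', cancel in the derivative of E. Convexity, \<beta>' \<le> \<beta>/\<delta> and \<epsilon>' \<le> 0
  then bound this derivative by \<beta> \<epsilon> |ps|^2 / (2 \<delta>) minus the sum of four nonnegative
  terms, which are up to constants the integrands of part (ii). As \<beta> \<epsilon> is integrable, E is
  bounded and the four terms are integrable. The rates in part (i) follow since gap is the Bregman distance of
  \<Phi> to ps plus |K p - b|^2 / 2, and the Bregman distance dominates |\<nabla>\<Phi> p - \<nabla>\<Phi>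
  ps|^2 up to a constant by cocoercivity.
\<close>

subsection \<open>Hilbert spaces and convex functions\<close>

text \<open>The representing vector is the minimiser of |u|^2 - 2 \<phi>(u).\<close>

lemma Riesz_representation:
  fixes \<phi> :: "'a::{real_inner, complete_space} \<Rightarrow> real"
  assumes "bounded_linear \<phi>"
  obtains w where "\<And>h. \<phi> h = h \<bullet> w"
proof -
  interpret \<phi>: bounded_linear \<phi> by fact
  define J where "J u = u \<bullet> u - 2 * \<phi> u" for u
  obtain M where M: "\<And>u. norm (\<phi> u) \<le> norm u * M"
    using \<phi>.bounded by blast
  have "- M\<^sup>2 \<le> J u" for u
  proof -
    have "\<phi> u \<le> norm u * M" using M[of u] by simp
    moreover have "0 \<le> (norm u - M)\<^sup>2" by simp
    ultimately show ?thesis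
      by (simp add: J_def power2_norm_eq_inner[symmetric] power2_diff)
  qed
  then have bdd: "bdd_below (range J)" by (auto intro!: bdd_belowI[of _ "- M\<^sup>2"])
  define m where "m = Inf (range J)"
  have m_le: "m \<le> J u" for u
    unfolding m_def by (rule cInf_lower[OF _ bdd]) simp
  have "\<exists>u. J u < m + 1 / real (Suc n)" for n
    using cInf_lessD[of "range J" "m + 1 / real (Suc n)"] by (auto simp: m_def)
  then obtain u where u: "\<And>n. J (u n) < m + 1 / real (Suc n)" by metis
  \<comment> \<open>The linear part of \<open>J\<close> cancels in this combination, so the
    parallelogram law passes from the squared norm to \<open>J\<close> and turns near-minimality
    into closeness.\<close>
  have parallelogram: "(dist v w)\<^sup>2 = 2 * J v + 2 * J w - 4 * J ((1/2) *\<^sub>R (v + w))" for v w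
    unfolding J_def dist_norm power2_norm_eq_inner
    by (simp add: \<phi>.add \<phi>.scaleR inner_add inner_diff inner_commute algebra_simps)
  have "Cauchy u"
  proof (rule metric_CauchyI)
    fix e :: real assume "e > 0"
    \<comment> \<open>From index \<open>N\<close> on, \<open>J\<close> is below
      \<open>m + 1 / N\<close>, while the midpoint of two such terms has \<open>J\<close> at least
      \<open>m\<close>. The parallelogram identity then bounds the squared distance by 4 /
      \<open>N\<close>, which this choice makes less than the square of \<open>e\<close>.\<close>
    obtain N where N: "4 / e\<^sup>2 < real N" using reals_Archimedean2 by blast
    then have "N > 0" using \<open>e > 0\<close>
      by (metis divide_nonneg_nonneg not_gr_zero of_nat_0 not_less zero_le_numeral zero_le_power2)
    have small: "4 / real N < e\<^sup>2"
      using N \<open>e > 0\<close> \<open>N > 0\<close> by (simp add: field_simps)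
    have near: "J (u n) < m + 1 / real N" if "n \<ge> N" for n
    proof -
      have "1 / real (Suc n) \<le> 1 / real N" using that \<open>N > 0\<close> by (simp add: frac_le)
      then show ?thesis using u[of n] by linarith
    qed
    have "dist (u n) (u k) < e" if "n \<ge> N" "k \<ge> N" for n k
    proof -
      have "(dist (u n) (u k))\<^sup>2 < 4 * (1 / real N)"
        using parallelogram[of "u n" "u k"] near[OF that(1)] near[OF that(2)]
          m_le[of "(1/2) *\<^sub>R (u n + u k)"] by linarith
      also have "\<dots> < e\<^sup>2" using small by simp
      finally show ?thesis by (rule power_less_imp_less_base) (use \<open>e > 0\<close> in simp)
    qed
    then show "\<exists>N. \<forall>n\<ge>N. \<forall>k\<ge>N. dist (u n) (u k) < e" by blast
  qed
  then obtain w where w: "u \<longlonglongrightarrow> w" using Cauchy_convergent convergent_def by blast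
  have "(\<lambda>n. J (u n)) \<longlonglongrightarrow> J w"
    unfolding J_def by (intro tendsto_intros w \<phi>.tendsto)
  moreover have "(\<lambda>n. m + 1 / real (Suc n)) \<longlonglongrightarrow> m + 0"
    by (intro tendsto_add tendsto_const lim_1_over_n[THEN LIMSEQ_Suc])
  ultimately have "J w \<le> m + 0"
    by (rule LIMSEQ_le) (use u in \<open>auto intro: less_imp_le\<close>)
  then have min: "J w \<le> J v" for v using m_le[of v] by simp
  have "(J has_derivative (\<lambda>h. 2 * (h \<bullet> w) - 2 * \<phi> h)) (at w)"
    unfolding J_def
    by (auto intro!: derivative_eq_intros \<phi>.has_derivative simp: inner_commute)
  then have "(\<lambda>h. 2 * (h \<bullet> w) - 2 * \<phi> h) = (\<lambda>h. 0)"
    by (rule has_derivative_local_min) (simp add: min)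
  then have "\<phi> h = h \<bullet> w" for h by (drule_tac x = h in fun_cong) simp
  then show ?thesis by (rule that)
qed

text \<open>\<open>adjoint\<close> chooses among the maps with this property. Riesz applied to
  \<open>\<lambda>u. T u \<bullet> w\<close>, for each \<open>w\<close>, shows that one exists, so
  the choice has the property.\<close>

lemma adjoint_works_Hilbert:
  fixes T :: "'a::{real_inner, complete_space} \<Rightarrow> 'b::real_inner"
  assumes "bounded_linear T"
  shows "T u \<bullet> w = u \<bullet> adjoint T w"
proof -
  have "\<exists>v. \<forall>u. T u \<bullet> w = u \<bullet> v" for w
    using Riesz_representation[OF bounded_linear_compose[OF bounded_linear_inner_left assms, of w]]
    by metis
  then have "\<exists>S. \<forall>u w. T u \<bullet> w = u \<bullet> S w" by metis
  then have "\<forall>u w. T u \<bullet> w = u \<bullet> adjoint T w"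
    unfolding adjoint_def by (rule someI_ex)
  then show ?thesis by blast
qed

text \<open>Chain rule relative to a set \<open>S\<close>, because at the initial time
  \<open>t0\<close> the trajectory has only a one-sided derivative.\<close>

lemma GDERIV_along_curve:
  assumes "GDERIV f (c t) :> d" and "(c has_vector_derivative v) (at t within S)"
  shows "((\<lambda>t. f (c t)) has_real_derivative d \<bullet> v) (at t within S)"
proof -
  have "(f has_derivative (\<lambda>h. h \<bullet> d)) (at (c t))"
    using assms(1) by (simp add: gderiv_def)
  from has_derivative_compose[OF assms(2)[unfolded has_vector_derivative_def] this]
  show ?thesis
    unfolding has_field_derivative_def
    by (simp add: inner_commute mult_commute_abs)
qed

lemma inner_self_has_real_derivative:
  assumes "(u has_vector_derivative u') (at t within S)"
  shows "((\<lambda>t. u t \<bullet> u t) has_real_derivative 2 * (u t \<bullet> u')) (at t within S)"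
  using has_derivative_inner[OF assms[unfolded has_vector_derivative_def]
    assms[unfolded has_vector_derivative_def]]
  unfolding has_field_derivative_def
  by (rule has_derivative_eq_rhs) (auto simp: inner_commute)

text \<open>Restriction to the line through \<open>p\<close> and \<open>q\<close> reduces this to
  the tangent inequality in one real variable, with tangent at 0 and evaluation at 1.\<close>

lemma convex_on_above_tangent_plane:
  fixes f :: "'a::real_inner \<Rightarrow> real"
  assumes "convex_on UNIV f" and "GDERIV f p :> d"
  shows "f p + d \<bullet> (q - p) \<le> f q"
proof -
  let ?c = "\<lambda>s::real. p + s *\<^sub>R (q - p)"
  have "convex_on UNIV (\<lambda>s. f (?c s))"
  proof (rule convex_onI)
    fix t r s :: real assume "0 < t" "t < 1"
    have "?c ((1 - t) *\<^sub>R r + t *\<^sub>R s) = (1 - t) *\<^sub>R ?c r + t *\<^sub>R ?c s"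
      by (simp add: algebra_simps)
    then show "f (?c ((1 - t) *\<^sub>R r + t *\<^sub>R s)) \<le> (1 - t) * f (?c r) + t * f (?c s)"
      using convex_onD[OF assms(1), of t "?c r" "?c s"] \<open>0 < t\<close> \<open>t < 1\<close> by simp
  qed simp
  moreover have "((\<lambda>s. f (?c s)) has_real_derivative d \<bullet> (q - p)) (at 0)"
    by (rule GDERIV_along_curve) (use assms(2) in \<open>auto intro!: derivative_eq_intros\<close>)
  ultimately show ?thesis
    using convex_on_imp_above_tangent[of UNIV "\<lambda>s. f (?c s)" 0 1 "d \<bullet> (q - p)"] by simp
qed

text \<open>\<open>?h\<close> is \<open>f\<close> on the segment minus the linear and quadratic
  terms of the bound. Cauchy-Schwarz and the Lipschitz condition make its derivative nonpositive on
  [0, 1], and \<open>?h 1 \<le> ?h 0\<close> is the claim.\<close>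

lemma descent_lemma:
  fixes f :: "'a::real_inner \<Rightarrow> real"
  assumes grad: "\<And>u. GDERIV f u :> F u" and lip: "L-lipschitz_on UNIV F"
  shows "f q \<le> f p + F p \<bullet> (q - p) + L / 2 * (norm (q - p))\<^sup>2"
proof -
  let ?d = "q - p"
  let ?c = "\<lambda>s::real. p + s *\<^sub>R ?d"
  let ?h = "\<lambda>s. f (?c s) - s * (F p \<bullet> ?d) - L / 2 * (norm ?d)\<^sup>2 * s\<^sup>2"
  have deriv: "(?h has_real_derivative F (?c s) \<bullet> ?d - F p \<bullet> ?d - L * (norm ?d)\<^sup>2 * s) (at s)" for s
    by (rule derivative_eq_intros GDERIV_along_curve[where d = "F (?c s)" and v = ?d] grad refl
        | simp)+
  have "?h 1 \<le> ?h 0"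
  proof (rule DERIV_nonpos_imp_nonincreasing[of 0 1 ?h])
    fix s :: real assume s: "0 \<le> s" "s \<le> 1"
    have "(F (?c s) - F p) \<bullet> ?d \<le> norm (F (?c s) - F p) * norm ?d"
      by (rule norm_cauchy_schwarz)
    also have "norm (F (?c s) - F p) \<le> L * (s * norm ?d)"
      using lipschitz_onD[OF lip, of "?c s" p] s by (simp add: dist_norm)
    finally have "(F (?c s) - F p) \<bullet> ?d \<le> L * (s * norm ?d) * norm ?d"
      by (simp add: mult_right_mono)
    then have "F (?c s) \<bullet> ?d - F p \<bullet> ?d - L * (norm ?d)\<^sup>2 * s \<le> 0"
      by (simp only: inner_diff_left power2_eq_square mult_ac diff_le_0_iff_le)
    then show "\<exists>y. (?h has_real_derivative y) (at s) \<and> y \<le> 0" using deriv by blast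
  qed simp
  then show ?thesis by simp
qed

text \<open>At \<open>?v\<close> the tangent plane at \<open>p\<close> bounds \<open>f\<close> from
  below and the descent lemma at \<open>q\<close> bounds it from above. Comparing the two bounds
  leaves the squared gradient difference.\<close>

lemma Bregman_ge_norm_grad_diff:
  fixes f :: "'a::real_inner \<Rightarrow> real"
  assumes "convex_on UNIV f" and grad: "\<And>u. GDERIV f u :> F u"
    and lip: "L-lipschitz_on UNIV F" and "L > 0"
  shows "(norm (F q - F p))\<^sup>2 \<le> 2 * L * (f q - f p - F p \<bullet> (q - p))"
proof -
  let ?w = "F q - F p"
  \<comment> \<open>Minimiser over v of the quadratic upper bound for f v - F p \<bullet> v around q\<close>
  let ?v = "q - (1 / L) *\<^sub>R ?w"
  have "f p + F p \<bullet> (?v - p) \<le> f ?v"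
    by (rule convex_on_above_tangent_plane[OF assms(1) grad])
  also have "f ?v \<le> f q + F q \<bullet> (?v - q) + L / 2 * (norm (?v - q))\<^sup>2"
    by (rule descent_lemma[OF grad lip])
  finally have "f p + F p \<bullet> (?v - p) \<le> f q + F q \<bullet> (?v - q) + L / 2 * (norm (?v - q))\<^sup>2" .
  moreover have "(norm (?v - q))\<^sup>2 = (norm ?w)\<^sup>2 / L\<^sup>2"
    using \<open>L > 0\<close> by (simp add: power_divide)
  moreover have "F q \<bullet> (?v - q) - F p \<bullet> (?v - p) = - (norm ?w)\<^sup>2 / L - F p \<bullet> (q - p)"
    unfolding power2_norm_eq_inner using \<open>L > 0\<close>
    by (simp add: inner_diff inner_add inner_commute field_simps)
  ultimately have "(norm ?w)\<^sup>2 / L - L / 2 * ((norm ?w)\<^sup>2 / L\<^sup>2) \<le> f q - f p - F p \<bullet> (q - p)"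
    by simp
  then show ?thesis using \<open>L > 0\<close> by (simp add: field_simps power2_eq_square)
qed

subsection \<open>Integrability on half-lines\<close>

lemma set_borel_measurable_continuous_on:
  fixes f :: "real \<Rightarrow> real"
  assumes "continuous_on {a..} f"
  shows "set_borel_measurable lborel {a..} f"
  using borel_measurable_continuous_on_indicator[of "{a..}" f] assms
  by (simp add: set_borel_measurable_def)

text \<open>Monotone convergence for the truncations \<open>?s n\<close> to
  \<open>{a..a + real n}\<close>: their integrals increase and stay below \<open>C\<close>, hence
  converge.\<close>

lemma set_integrable_atLeast_of_bounded_integrals:
  fixes D :: "real \<Rightarrow> real"
  assumes cont: "continuous_on {a..} D" and nonneg: "\<And>t. t \<ge> a \<Longrightarrow> D t \<ge> 0"
    and bound: "\<And>t. t \<ge> a \<Longrightarrow> integral {a..t} D \<le> C"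
  shows "set_integrable lborel {a..} D"
proof -
  let ?s = "\<lambda>n::nat. \<lambda>t. indicator {a..a + real n} t *\<^sub>R D t"
  have int: "set_integrable lborel {a..a + real n} D" for n
    by (intro borel_integrable_atLeastAtMost' continuous_on_subset[OF cont]) auto
  have lint: "(LINT t|lborel. ?s n t) = integral {a..a + real n} D" for n
    using set_borel_integral_eq_integral(2)[OF int] by (simp add: set_lebesgue_integral_def)
  have mono: "mono (\<lambda>n. ?s n t)" for t
    by (rule monoI) (use nonneg in \<open>auto simp: indicator_def\<close>)
  have "incseq (\<lambda>n. LINT t|lborel. ?s n t)"
    by (rule monoI, rule integral_mono)
      (rule int[unfolded set_integrable_def], rule int[unfolded set_integrable_def],
        rule monoD[OF mono])
  moreover have "\<forall>n. (LINT t|lborel. ?s n t) \<le> C" using bound lint by simp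
  ultimately obtain J where J: "(\<lambda>n. LINT t|lborel. ?s n t) \<longlonglongrightarrow> J"
    using incseq_convergent by blast
  have lim: "(\<lambda>n. ?s n t) \<longlonglongrightarrow> indicator {a..} t *\<^sub>R D t" for t
  proof -
    obtain N where N: "t - a < real N" using reals_Archimedean2 by blast
    have "eventually (\<lambda>n. ?s n t = indicator {a..} t *\<^sub>R D t) sequentially"
      using eventually_ge_at_top[of N] by eventually_elim (use N in \<open>auto simp: indicator_def\<close>)
    then show ?thesis by (rule tendsto_eventually)
  qed
  show ?thesis
    unfolding set_integrable_def
  proof (rule integrable_monotone_convergence[where f = ?s])
    show "integrable lborel (?s n)" for n using int by (simp add: set_integrable_def)
    show "AE t in lborel. mono (\<lambda>n. ?s n t)" using mono by simp
    show "AE t in lborel. (\<lambda>n. ?s n t) \<longlonglongrightarrow> indicator {a..} t *\<^sub>R D t" using lim by simp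
    show "(\<lambda>n. LINT t|lborel. ?s n t) \<longlonglongrightarrow> J" by fact
    show "(\<lambda>t. indicator {a..} t *\<^sub>R D t) \<in> borel_measurable lborel"
      using set_borel_measurable_continuous_on[OF cont] by (simp add: set_borel_measurable_def)
  qed
qed

lemma integral_has_real_derivative_atLeast:
  fixes D :: "real \<Rightarrow> real"
  assumes "continuous_on {a..} D" and "t > a"
  shows "((\<lambda>t. integral {a..t} D) has_real_derivative D t) (at t)"
proof -
  have "((\<lambda>t. integral {a..t} D) has_real_derivative D t) (at t within {a..t + 1})"
    by (rule integral_has_real_derivative)
      (use assms in \<open>auto intro: continuous_on_subset\<close>)
  moreover have "at t within {a..t + 1} = at t"
    by (rule at_within_interior) (use assms in auto)
  ultimately show ?thesis by simp
qed

text \<open>\<open>G\<close>, the sum of \<open>E\<close> and the accumulated \<open>D\<close> minus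
  the accumulated \<open>h\<close>, has nonpositive derivative and so never exceeds
  \<open>G a\<close>. The differential inequality is asked for only at interior times; continuity of
  \<open>G\<close> covers the endpoint \<open>a\<close>.\<close>

lemma dissipation:
  fixes E E' D h :: "real \<Rightarrow> real"
  assumes E_cont: "continuous_on {a..} E"
    and E_deriv: "\<And>t. t > a \<Longrightarrow> (E has_real_derivative E' t) (at t)"
    and ineq: "\<And>t. t > a \<Longrightarrow> E' t \<le> h t - D t"
    and E_nonneg: "\<And>t. t \<ge> a \<Longrightarrow> E t \<ge> 0"
    and D_cont: "continuous_on {a..} D" and D_nonneg: "\<And>t. t \<ge> a \<Longrightarrow> D t \<ge> 0"
    and h_cont: "continuous_on {a..} h" and h_nonneg: "\<And>t. t \<ge> a \<Longrightarrow> h t \<ge> 0"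
    and h_int: "set_integrable lborel {a..} h"
  shows "\<exists>C. \<forall>t\<ge>a. E t \<le> C" and "set_integrable lborel {a..} D"
proof -
  define H where "H = integral {a..} h"
  define G where "G t = E t + integral {a..t} D - integral {a..t} h" for t
  have ioncl: "k integrable_on {a..t}" if "continuous_on {a..} k" for k :: "real \<Rightarrow> real" and t
    by (rule integrable_continuous_interval) (use that in \<open>auto intro: continuous_on_subset\<close>)
  have G_le: "G t \<le> G a" if "t \<ge> a" for t
  proof (rule DERIV_nonpos_imp_decreasing_open[OF that])
    fix s assume "a < s" "s < t"
    then have "(G has_real_derivative E' s + D s - h s) (at s)"
      unfolding G_def
      by (intro derivative_intros E_deriv integral_has_real_derivative_atLeast D_cont h_cont)
    then show "\<exists>y. (G has_real_derivative y) (at s) \<and> y \<le> 0"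
      using ineq[OF \<open>a < s\<close>] by (intro exI[of _ "E' s + D s - h s"]) auto
  next
    show "continuous_on {a..t} G"
      unfolding G_def
      by (intro continuous_intros indefinite_integral_continuous_1 ioncl D_cont h_cont
          continuous_on_subset[OF E_cont]) auto
  qed
  \<comment> \<open>Both claims come from this inequality: dropping the integral of \<open>D\<close>
    bounds \<open>E\<close>, and dropping \<open>E\<close> bounds the integrals of
    \<open>D\<close>.\<close>
  have main: "E t + integral {a..t} D \<le> E a + H" if "t \<ge> a" for t
  proof -
    have "integral {a..t} h \<le> H"
      unfolding H_def
      by (rule integral_subset_le)
        (use set_borel_integral_eq_integral(1)[OF h_int] h_nonneg ioncl[OF h_cont] in auto)
    then show ?thesis using G_le[OF that] by (simp add: G_def)
  qed
  have "E t \<le> E a + H" if "t \<ge> a" for t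
  proof -
    have "0 \<le> integral {a..t} D"
      by (rule integral_nonneg[OF ioncl[OF D_cont]]) (simp add: D_nonneg)
    then show ?thesis using main[OF that] by linarith
  qed
  then show "\<exists>C. \<forall>t\<ge>a. E t \<le> C" by blast
  have "integral {a..t} D \<le> E a + H" if "t \<ge> a" for t
    using main[OF that] E_nonneg[OF that] by linarith
  with D_cont D_nonneg show "set_integrable lborel {a..} D"
    by (rule set_integrable_atLeast_of_bounded_integrals)
qed

lemma set_integrable_atLeast_dominated:
  fixes D k :: "real \<Rightarrow> real"
  assumes "set_integrable lborel {a..} D" and "continuous_on {a..} k"
    and "\<And>t. t \<ge> a \<Longrightarrow> 0 \<le> k t" and "\<And>t. t \<ge> a \<Longrightarrow> k t \<le> D t"
  shows "set_integrable lborel {a..} k"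
proof (rule set_integrable_bound[OF assms(1) set_borel_measurable_continuous_on[OF assms(2)]])
  show "AE t in lborel. t \<in> {a..} \<longrightarrow> norm (k t) \<le> norm (D t)"
    by (rule AE_I2) (use assms(3,4) order_trans[OF assms(3,4)] in \<open>simp add: abs_of_nonneg\<close>)
qed

subsection \<open>The Lyapunov function of the one-block flow\<close>

text \<open>The system with both primal blocks merged: \<open>p\<close> stands for the pair (x, y),
  \<open>K\<close> for the map sending it to Ax + By, and \<open>S\<close> for the adjoint of
  \<open>K\<close>. The saddle point enters through \<open>feasible\<close> and
  \<open>minimal\<close>; the latter is the right-hand saddle inequality, whose value at
  \<open>ps\<close> is \<open>\<Phi> ps\<close> by feasibility.\<close>

locale primal_dual_flow =
  fixes K :: "'p::real_inner \<Rightarrow> 'z::real_inner" and S :: "'z \<Rightarrow> 'p" and b :: 'z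
    and \<Phi> :: "'p \<Rightarrow> real" and G :: "'p \<Rightarrow> 'p" and L t0 \<gamma> \<delta> :: real
    and \<beta> \<beta>' \<epsilon> \<epsilon>' :: "real \<Rightarrow> real"
    and p p' p'' :: "real \<Rightarrow> 'p" and l l' :: "real \<Rightarrow> 'z"
    and ps :: 'p and ls :: 'z
  assumes K: "bounded_linear K" and adjoint: "K u \<bullet> w = u \<bullet> S w"
    and convex: "convex_on UNIV \<Phi>" and grad: "GDERIV \<Phi> u :> G u"
    and L: "L > 0" and lipschitz: "L-lipschitz_on UNIV G"
    and delta: "\<delta> > 0" and delta_gamma: "1 / \<delta> < \<gamma>"
    and beta_pos: "t \<ge> t0 \<Longrightarrow> \<beta> t > 0"
    and beta_mono: "mono_on {t0..} \<beta>"
    and beta_deriv: "t \<ge> t0 \<Longrightarrow> (\<beta> has_real_derivative \<beta>' t) (at t within {t0..})"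
    and beta_C1: "continuous_on {t0..} \<beta>'"
    and beta_growth: "t \<ge> t0 \<Longrightarrow> \<beta>' t \<le> 1 / \<delta> * \<beta> t"
    and eps_nonneg: "t \<ge> t0 \<Longrightarrow> \<epsilon> t \<ge> 0"
    and eps_antimono: "antimono_on {t0..} \<epsilon>"
    and eps_deriv: "t \<ge> t0 \<Longrightarrow> (\<epsilon> has_real_derivative \<epsilon>' t) (at t within {t0..})"
    and beta_eps_int: "set_integrable lborel {t0..} (\<lambda>t. \<beta> t * \<epsilon> t)"
    and p_deriv: "t \<ge> t0 \<Longrightarrow> (p has_vector_derivative p' t) (at t within {t0..})"
    and p_deriv2: "t \<ge> t0 \<Longrightarrow> (p' has_vector_derivative p'' t) (at t within {t0..})"
    and l_deriv: "t \<ge> t0 \<Longrightarrow> (l has_vector_derivative l' t) (at t within {t0..})"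
    and flow_p: "t \<ge> t0 \<Longrightarrow> p'' t + \<gamma> *\<^sub>R p' t
        + \<beta> t *\<^sub>R (G (p t) + S (l t) + S (K (p t) - b) + \<epsilon> t *\<^sub>R p t) = 0"
    and flow_l: "t \<ge> t0 \<Longrightarrow> l' t = \<beta> t *\<^sub>R (K (p t + \<delta> *\<^sub>R p' t) - b)"
    and feasible: "K ps = b"
    and minimal: "\<Phi> ps \<le> \<Phi> q + ls \<bullet> (K q - b) + 1 / 2 * (norm (K q - b))\<^sup>2"
begin

interpretation K: bounded_linear K by (rule K)

section \<open>The Lagrangian gap and the quantities it controls\<close>

definition gap :: "'p \<Rightarrow> real" where
  "gap q = \<Phi> q - \<Phi> ps + ls \<bullet> (K q - b) + 1 / 2 * (norm (K q - b))\<^sup>2"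

text \<open>The gradient of \<open>gap\<close>. The bracket in \<open>flow_p\<close> is this vector
  plus \<open>S (l t) - S ls + \<epsilon> t *\<^sub>R p t\<close>, so the deviation of the
  multiplier is separated from the gap.\<close>

definition gap_grad :: "'p \<Rightarrow> 'p" where
  "gap_grad q = G q + S ls + S (K q - b)"

text \<open>Pairing with \<open>v\<close> moves every \<open>S\<close> onto \<open>K v\<close>, so
  that later computations can use the linearity of \<open>K\<close>.\<close>

lemma gap_grad_inner: "gap_grad q \<bullet> v = G q \<bullet> v + K v \<bullet> ls + K v \<bullet> (K q - b)"
  unfolding gap_grad_def adjoint by (simp add: inner_add_right inner_commute[of _ v])

lemma gap_GDERIV: "GDERIV gap q :> gap_grad q"
proof -
  note [derivative_intros] = grad[unfolded gderiv_def] K.has_derivative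
  show ?thesis
    unfolding gderiv_def gap_def[abs_def] gap_grad_def power2_norm_eq_inner
    by (auto intro!: derivative_eq_intros simp: inner_add_right adjoint[symmetric] inner_commute)
qed

lemma gap_nonneg: "0 \<le> gap q"
  using minimal[of q] by (simp add: gap_def)

text \<open>\<open>gap\<close> is nonnegative and vanishes at \<open>ps\<close>, so its derivative
  there is zero; evaluating this derivative at \<open>gap_grad ps\<close> itself gives a zero
  squared norm.\<close>

lemma stationary: "gap_grad ps = 0"
proof -
  have "gap ps = 0" by (simp add: gap_def feasible)
  then have "(\<lambda>h. h \<bullet> gap_grad ps) = (\<lambda>h. 0)"
    using gap_GDERIV[of ps] unfolding gderiv_def
    by (intro has_derivative_local_min[of gap _ ps]) (simp_all add: gap_nonneg)
  then have "gap_grad ps \<bullet> gap_grad ps = 0" by (drule_tac x = "gap_grad ps" in fun_cong) simp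
  then show ?thesis by simp
qed

lemma K_diff_ps: "K (q - ps) = K q - b"
  by (simp add: K.diff feasible)

text \<open>Stationarity paired with \<open>q - ps\<close> identifies the multiplier term
  \<open>ls \<bullet> (K q - b)\<close> with the linear term
  \<open>- G ps \<bullet> (q - ps)\<close>.\<close>

lemma gap_eq_Bregman:
  "gap q = (\<Phi> q - \<Phi> ps - G ps \<bullet> (q - ps)) + 1 / 2 * (norm (K q - b))\<^sup>2"
proof -
  have "gap_grad ps \<bullet> (q - ps) = 0" by (simp add: stationary)
  then have "G ps \<bullet> (q - ps) + ls \<bullet> (K q - b) = 0"
    unfolding gap_grad_inner K_diff_ps by (simp add: feasible inner_commute)
  then show ?thesis by (simp add: gap_def)
qed

lemma residual_le_gap: "(norm (K q - b))\<^sup>2 \<le> 2 * gap q"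
  using convex_on_above_tangent_plane[OF convex grad, of ps q] by (simp add: gap_eq_Bregman)

lemma grad_diff_le_gap: "(norm (G q - G ps))\<^sup>2 \<le> 2 * L * gap q"
proof -
  have "(norm (G q - G ps))\<^sup>2 \<le> 2 * L * (\<Phi> q - \<Phi> ps - G ps \<bullet> (q - ps))"
    by (rule Bregman_ge_norm_grad_diff[OF convex grad lipschitz L])
  also have "\<dots> \<le> 2 * L * gap q"
    using L by (simp add: gap_eq_Bregman)
  finally show ?thesis .
qed

text \<open>Removing half the squared residual from \<open>gap q\<close> leaves a number between 0
  and \<open>gap q\<close>. The objective difference is that number minus
  \<open>ls \<bullet> (K q - b)\<close>, estimated by Cauchy-Schwarz.\<close>

lemma objective_diff_le_gap: "\<bar>\<Phi> q - \<Phi> ps\<bar> \<le> gap q + norm ls * norm (K q - b)"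
proof -
  have "\<bar>ls \<bullet> (K q - b)\<bar> \<le> norm ls * norm (K q - b)" by (rule Cauchy_Schwarz_ineq2)
  moreover have "0 \<le> (norm (K q - b))\<^sup>2" by simp
  ultimately show ?thesis
    using residual_le_gap[of q] gap_def[of q] by linarith
qed

text \<open>The tangent plane at \<open>q\<close> is evaluated at \<open>ps\<close>. The penalty
  contributes the full squared residual on the right but only half of it to \<open>gap q\<close>;
  the spare half later yields the integrability of the residual.\<close>

lemma gap_add_residual_le: "gap q + 1 / 2 * (norm (K q - b))\<^sup>2 \<le> gap_grad q \<bullet> (q - ps)"
proof -
  have "\<Phi> q + G q \<bullet> (ps - q) \<le> \<Phi> ps"
    by (rule convex_on_above_tangent_plane[OF convex grad])
  then show ?thesis
    unfolding gap_def gap_grad_inner K_diff_ps power2_norm_eq_inner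
    by (simp add: inner_diff_right inner_diff_left inner_commute[of ls])
qed

section \<open>The energy and its derivative along the flow\<close>

definition energy :: "real \<Rightarrow> real" where
  "energy t = \<beta> t * (gap (p t) + \<epsilon> t / 2 * (p t \<bullet> p t))
     + 1 / 2 * (((1 / \<delta>) *\<^sub>R (p t - ps) + p' t) \<bullet> ((1 / \<delta>) *\<^sub>R (p t - ps) + p' t))
     + (\<gamma> - 1 / \<delta>) / (2 * \<delta>) * ((p t - ps) \<bullet> (p t - ps))
     + 1 / (2 * \<delta>) * ((l t - ls) \<bullet> (l t - ls))"

text \<open>The derivative of \<open>energy\<close> after cancellation: the multiplier has
  disappeared, and so have the products of \<open>p' t\<close> with \<open>p t - ps\<close>,
  \<open>p t\<close> and \<open>gap_grad (p t)\<close>.\<close>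

definition energy_rate :: "real \<Rightarrow> real" where
  "energy_rate t = \<beta>' t * gap (p t) + (\<beta>' t * \<epsilon> t + \<beta> t * \<epsilon>' t) / 2 * (p t \<bullet> p t)
     - (\<gamma> - 1 / \<delta>) * (p' t \<bullet> p' t) - \<beta> t / \<delta> * (gap_grad (p t) \<bullet> (p t - ps))
     - \<beta> t * \<epsilon> t / \<delta> * (p t \<bullet> (p t - ps))"

definition dissipation_rate :: "real \<Rightarrow> real" where
  "dissipation_rate t = (\<gamma> - 1 / \<delta>) * (norm (p' t))\<^sup>2
     + (\<beta> t / \<delta> - \<beta>' t) * gap (p t)
     + \<beta> t * \<epsilon> t / (2 * \<delta>) * (norm (p t - ps))\<^sup>2
     + \<beta> t / (2 * \<delta>) * (norm (K (p t) - b))\<^sup>2"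

lemma energy_has_derivative:
  assumes t: "t \<ge> t0"
  shows "(energy has_real_derivative energy_rate t) (at t within {t0..})"
proof -
  define u where "u = p t - ps"
  define w where "w = l t - ls"
  define r where "r = K (p t) - b"
  have Ku: "K u = r" by (simp add: u_def r_def K_diff_ps)
  note derivs = beta_deriv[OF t] eps_deriv[OF t] GDERIV_along_curve[OF gap_GDERIV p_deriv[OF t]]
    inner_self_has_real_derivative[OF p_deriv[OF t]]
  have d_u: "((\<lambda>t. p t - ps) has_vector_derivative p' t) (at t within {t0..})"
    using has_vector_derivative_diff[OF p_deriv[OF t] has_vector_derivative_const] by simp
  have d_w: "((\<lambda>t. l t - ls) has_vector_derivative l' t) (at t within {t0..})"
    using has_vector_derivative_diff[OF l_deriv[OF t] has_vector_derivative_const] by simp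
  let ?e = "(1 / \<delta>) *\<^sub>R u + p' t" and ?e' = "(1 / \<delta>) *\<^sub>R p' t + p'' t"
  have halves: "1 / 2 * (2 * r) = r" "c / (2 * \<delta>) * (2 * r) = c / \<delta> * r" for r c :: real
    by auto
  have d_e: "((\<lambda>t. (1 / \<delta>) *\<^sub>R (p t - ps) + p' t) has_vector_derivative ?e') (at t within {t0..})"
    by (intro has_vector_derivative_add p_deriv2[OF t]
        bounded_linear.has_vector_derivative[OF bounded_linear_scaleR_right d_u])
  note derivs = derivs d_u[THEN inner_self_has_real_derivative]
    d_w[THEN inner_self_has_real_derivative] d_e[THEN inner_self_has_real_derivative]
  have "(energy has_real_derivative
      \<beta>' t * (gap (p t) + \<epsilon> t / 2 * (p t \<bullet> p t))
      + (gap_grad (p t) \<bullet> p' t + (\<epsilon>' t / 2 * (p t \<bullet> p t) + 2 * (p t \<bullet> p' t) * (\<epsilon> t / 2))) * \<beta> t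
      + 1 / 2 * (2 * (((1 / \<delta>) *\<^sub>R (p t - ps) + p' t) \<bullet> ?e'))
      + (\<gamma> - 1 / \<delta>) / (2 * \<delta>) * (2 * ((p t - ps) \<bullet> p' t))
      + 1 / (2 * \<delta>) * (2 * ((l t - ls) \<bullet> l' t))) (at t within {t0..})"
    unfolding energy_def[abs_def]
    by (intro DERIV_add DERIV_cmult DERIV_mult DERIV_cdivide derivs)
  then have energy_deriv: "(energy has_real_derivative
      \<beta> t * (gap_grad (p t) \<bullet> p' t + (\<epsilon> t * (p t \<bullet> p' t) + \<epsilon>' t / 2 * (p t \<bullet> p t)))
      + \<beta>' t * (gap (p t) + \<epsilon> t / 2 * (p t \<bullet> p t))
      + ?e \<bullet> ?e' + (\<gamma> - 1 / \<delta>) / \<delta> * (u \<bullet> p' t) + 1 / \<delta> * (w \<bullet> l' t)) (at t within {t0..})"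
    unfolding u_def[symmetric] w_def[symmetric] halves
    by (rule DERIV_cong) (simp add: algebra_simps)
  \<comment> \<open>The flow equation eliminates \<open>p''\<close>. For \<open>e = ?e\<close>, the
    friction term contains
    \<open>- (\<gamma> - 1 / \<delta>) / \<delta> * (u \<bullet> p' t)\<close>, which cancels the
    derivative of the weighted squared distance in \<open>energy\<close>; this fixes the
    weight.\<close>
  have velocity: "e \<bullet> ?e' = - (\<gamma> - 1 / \<delta>) * (e \<bullet> p' t)
      - \<beta> t * (G (p t) \<bullet> e + K e \<bullet> l t + K e \<bullet> r + \<epsilon> t * (p t \<bullet> e))" for e
  proof -
    have p'': "p'' t = - (\<gamma> *\<^sub>R p' t + \<beta> t *\<^sub>R (G (p t) + S (l t) + S r + \<epsilon> t *\<^sub>R p t))"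
      using flow_p[OF t] by (simp only: eq_neg_iff_add_eq_0 r_def add.assoc)
    have "?e' = - (\<gamma> - 1 / \<delta>) *\<^sub>R p' t
        - \<beta> t *\<^sub>R (G (p t) + S (l t) + S r + \<epsilon> t *\<^sub>R p t)"
      unfolding p'' by (simp add: algebra_simps)
    then show ?thesis
      by (simp only: inner_diff_right inner_scaleR_right inner_add_right adjoint[symmetric]
          inner_commute[of "G (p t)"] inner_commute[of "p t"])
  qed
  \<comment> \<open>Since \<open>K ps = b\<close>, the residual at the extrapolated point
    \<open>p t + \<delta> *\<^sub>R p' t\<close> is \<delta> times \<open>K ?e\<close>. The term
    therefore cancels the part of \<open>K ?e \<bullet> l t\<close> in \<open>velocity\<close> that
    involves \<open>w\<close>.\<close>
  have multiplier: "1 / \<delta> * (w \<bullet> l' t) = \<beta> t * (K ?e \<bullet> w)"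
  proof -
    have "K (p t + \<delta> *\<^sub>R p' t) - b = \<delta> *\<^sub>R K ?e"
      using delta by (simp add: K.add K.scaleR Ku r_def algebra_simps)
    then show ?thesis
      using delta by (simp add: flow_l[OF t] inner_commute)
  qed
  have gap_grad: "gap_grad (p t) \<bullet> v = G (p t) \<bullet> v + K v \<bullet> ls + K v \<bullet> r" for v
    by (simp add: gap_grad_inner r_def)
  show ?thesis
    using energy_deriv unfolding energy_rate_def u_def[symmetric] velocity[of ?e] multiplier gap_grad
    by (elim DERIV_cong)
      (simp add: w_def Ku K.add K.scaleR inner_add_left inner_add_right inner_diff_right
        algebra_simps add_divide_distrib diff_divide_distrib)
qed

lemma at_within_t0: "t > t0 \<Longrightarrow> at t within {t0..} = at t"
  by (rule at_within_interior) simp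

lemma eps_deriv_nonpos:
  assumes "t > t0"
  shows "\<epsilon>' t \<le> 0"
proof -
  have "(\<epsilon> has_real_derivative \<epsilon>' t) (at t)"
    using eps_deriv[OF less_imp_le[OF assms]] unfolding at_within_t0[OF assms] .
  then have deriv: "((\<lambda>t. - \<epsilon> t) has_real_derivative - \<epsilon>' t) (at t)" by (rule DERIV_minus)
  have "mono_on {t0..} (\<lambda>t. - \<epsilon> t)"
    using eps_antimono by (simp add: monotone_on_def)
  from this deriv have "- \<epsilon>' t \<ge> 0"
    by (rule mono_on_imp_deriv_nonneg) (use assms in simp)
  then show ?thesis by simp
qed

text \<open>The growth condition on \<beta> and \<open>\<epsilon>' t \<le> 0\<close> control the
  regularisation terms, and \<open>gap_add_residual_le\<close> controls the gradient term. The one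
  positive remainder comes from the regularisation pulling towards 0 instead of
  \<open>ps\<close>.\<close>

lemma energy_rate_le:
  assumes t: "t > t0"
  shows "energy_rate t \<le> \<beta> t * \<epsilon> t * ((norm ps)\<^sup>2 / (2 * \<delta>)) - dissipation_rate t"
proof -
  have "\<beta> t > 0" "\<epsilon> t \<ge> 0" using beta_pos eps_nonneg t by auto
  have "\<beta>' t * \<epsilon> t + \<beta> t * \<epsilon>' t \<le> \<beta> t * \<epsilon> t / \<delta>"
    using mult_right_mono[OF beta_growth \<open>\<epsilon> t \<ge> 0\<close>, of t] t
      mult_nonneg_nonpos[OF less_imp_le[OF \<open>\<beta> t > 0\<close>] eps_deriv_nonpos[OF t]] by simp
  then have eps_term: "(\<beta>' t * \<epsilon> t + \<beta> t * \<epsilon>' t) / 2 * (p t \<bullet> p t) \<le> \<beta> t * \<epsilon> t / \<delta> / 2 * (p t \<bullet> p t)"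
    by (intro mult_right_mono divide_right_mono) auto
  have strong: "\<beta> t / \<delta> * (gap (p t) + 1 / 2 * (norm (K (p t) - b))\<^sup>2)
      \<le> \<beta> t / \<delta> * (gap_grad (p t) \<bullet> (p t - ps))"
    using \<open>\<beta> t > 0\<close> delta by (intro mult_left_mono gap_add_residual_le) auto
  \<comment> \<open>Polarisation: the three squares respectively cancel the bound in
    \<open>eps_term\<close>, give the dissipated distance, and give the remainder in
    \<open>ps\<close>.\<close>
  have inner_ps: "p t \<bullet> (p t - ps) = (p t \<bullet> p t + (norm (p t - ps))\<^sup>2 - (norm ps)\<^sup>2) / 2"
    by (simp add: power2_norm_eq_inner inner_diff inner_commute)
  have split: "k / \<delta> * ((a1 + a2 - a3) / 2) = k / \<delta> / 2 * a1 + k / (2 * \<delta>) * a2 - k * (a3 / (2 * \<delta>))"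
    for k a1 a2 a3 :: real
    by (simp add: add_divide_distrib diff_divide_distrib ring_distribs)
  have "\<beta> t * \<epsilon> t / \<delta> * (p t \<bullet> (p t - ps)) = \<beta> t * \<epsilon> t / \<delta> / 2 * (p t \<bullet> p t)
      + \<beta> t * \<epsilon> t / (2 * \<delta>) * (norm (p t - ps))\<^sup>2 - \<beta> t * \<epsilon> t * ((norm ps)\<^sup>2 / (2 * \<delta>))"
    unfolding inner_ps by (rule split)
  \<comment> \<open>Adding and subtracting \<open>\<beta>' t * gap (p t)\<close> exposes the first
    summand of \<open>energy_rate\<close>, which then cancels.\<close>
  moreover have "\<beta> t / \<delta> * (gap (p t) + 1 / 2 * (norm (K (p t) - b))\<^sup>2) =
      (\<beta> t / \<delta> - \<beta>' t) * gap (p t) + \<beta>' t * gap (p t) + \<beta> t / (2 * \<delta>) * (norm (K (p t) - b))\<^sup>2"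
    by (simp add: ring_distribs)
  ultimately show ?thesis
    using eps_term strong
    unfolding energy_rate_def dissipation_rate_def power2_norm_eq_inner[of "p' t"]
    by linarith
qed

section \<open>Continuity, signs and the energy estimate\<close>

lemma continuous_on_trajectory [continuous_intros]:
  "continuous_on {t0..} p" "continuous_on {t0..} p'" "continuous_on {t0..} \<beta>"
  "continuous_on {t0..} \<beta>'" "continuous_on {t0..} \<epsilon>"
  "continuous_on {t0..} (\<lambda>t. gap (p t))" "continuous_on {t0..} (\<lambda>t. K (p t))"
  "continuous_on {t0..} energy"
proof -
  show p: "continuous_on {t0..} p" and "continuous_on {t0..} p'"
    by (auto intro!: continuous_on_vector_derivative p_deriv p_deriv2)
  show "continuous_on {t0..} \<beta>" "continuous_on {t0..} \<epsilon>" "continuous_on {t0..} energy"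
    by (auto intro!: DERIV_continuous_on beta_deriv eps_deriv energy_has_derivative)
  show "continuous_on {t0..} \<beta>'" by (rule beta_C1)
  show "continuous_on {t0..} (\<lambda>t. K (p t))" by (rule K.continuous_on[OF p])
  show "continuous_on {t0..} (\<lambda>t. gap (p t))"
    by (auto intro!: DERIV_continuous_on GDERIV_along_curve gap_GDERIV p_deriv)
qed

lemma coefficients_nonneg:
  assumes "t \<ge> t0"
  shows "0 \<le> \<gamma> - 1 / \<delta>" "0 \<le> \<beta> t / \<delta> - \<beta>' t" "0 \<le> \<beta> t * \<epsilon> t / (2 * \<delta>)" "0 \<le> \<beta> t / (2 * \<delta>)"
    "0 \<le> \<beta> t" "0 \<le> \<epsilon> t" "0 \<le> \<delta>"
proof -
  show "0 \<le> \<beta> t" "0 \<le> \<epsilon> t" "0 \<le> \<delta>"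
    using beta_pos[OF assms] eps_nonneg[OF assms] delta by linarith+
  then show "0 \<le> \<beta> t * \<epsilon> t / (2 * \<delta>)" "0 \<le> \<beta> t / (2 * \<delta>)" by simp_all
  show "0 \<le> \<gamma> - 1 / \<delta>" "0 \<le> \<beta> t / \<delta> - \<beta>' t"
    using delta_gamma beta_growth[OF assms] by simp_all
qed

lemma dissipation_terms_nonneg:
  assumes "t \<ge> t0"
  shows "0 \<le> (\<gamma> - 1 / \<delta>) * (norm (p' t))\<^sup>2" "0 \<le> (\<beta> t / \<delta> - \<beta>' t) * gap (p t)"
    "0 \<le> \<beta> t * \<epsilon> t / (2 * \<delta>) * (norm (p t - ps))\<^sup>2"
    "0 \<le> \<beta> t / (2 * \<delta>) * (norm (K (p t) - b))\<^sup>2"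
  by (intro mult_nonneg_nonneg coefficients_nonneg[OF assms] gap_nonneg zero_le_power2)+

lemma energy_terms_nonneg:
  assumes "t \<ge> t0"
  shows "0 \<le> \<beta> t * gap (p t)" "0 \<le> \<beta> t * (\<epsilon> t / 2 * (p t \<bullet> p t))"
    "0 \<le> (\<gamma> - 1 / \<delta>) / (2 * \<delta>) * ((p t - ps) \<bullet> (p t - ps))"
    "0 \<le> 1 / (2 * \<delta>) * ((l t - ls) \<bullet> (l t - ls))"
  by (intro mult_nonneg_nonneg divide_nonneg_nonneg coefficients_nonneg[OF assms] gap_nonneg
      inner_ge_zero zero_le_one zero_le_numeral)+

lemma energy_nonneg: "t \<ge> t0 \<Longrightarrow> 0 \<le> energy t"
  unfolding energy_def distrib_left[of "\<beta> t"]
  by (intro add_nonneg_nonneg energy_terms_nonneg) auto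

text \<open>\<open>dissipation\<close> with the forcing \<open>?h\<close>, the remainder in
  \<open>energy_rate_le\<close>. It is a constant multiple of
  \<open>\<beta> t * \<epsilon> t\<close>, so its integrability is
  \<open>beta_eps_int\<close>.\<close>

lemma
  shows energy_bounded: "\<exists>C. \<forall>t\<ge>t0. energy t \<le> C"
    and dissipation_rate_integrable: "set_integrable lborel {t0..} dissipation_rate"
proof -
  let ?h = "\<lambda>t. \<beta> t * \<epsilon> t * ((norm ps)\<^sup>2 / (2 * \<delta>))"
  have 1: "(energy has_real_derivative energy_rate t) (at t)" if "t > t0" for t
    using energy_has_derivative[OF less_imp_le[OF that]] unfolding at_within_t0[OF that] .
  have 2: "continuous_on {t0..} dissipation_rate"
    unfolding dissipation_rate_def[abs_def] using delta by (intro continuous_intros) auto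
  have 3: "0 \<le> dissipation_rate t" if "t \<ge> t0" for t
    unfolding dissipation_rate_def
    by (intro add_nonneg_nonneg dissipation_terms_nonneg that)
  have 4: "continuous_on {t0..} ?h" by (intro continuous_intros)
  have 5: "0 \<le> ?h t" if "t \<ge> t0" for t
    using beta_pos[OF that] eps_nonneg[OF that] delta by simp
  have 6: "set_integrable lborel {t0..} ?h" using beta_eps_int by simp
  show "\<exists>C. \<forall>t\<ge>t0. energy t \<le> C" "set_integrable lborel {t0..} dissipation_rate"
    by (rule dissipation[OF continuous_on_trajectory(8) 1 energy_rate_le energy_nonneg 2 3 4 5 6];
        assumption)+
qed

section \<open>Boundedness of the trajectory and convergence rates\<close>

lemma trajectory_bounded: "\<exists>C. \<forall>t\<ge>t0. norm (p t) \<le> C \<and> norm (l t) \<le> C"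
proof -
  obtain C where C: "\<And>t. t \<ge> t0 \<Longrightarrow> energy t \<le> C" using energy_bounded by blast
  define c1 where "c1 = (\<gamma> - 1 / \<delta>) / (2 * \<delta>)"
  define c2 where "c2 = 1 / (2 * \<delta>)"
  \<comment> \<open>The strict inequality \<open>1 / \<delta> < \<gamma>\<close> makes
    \<open>c1\<close> positive, so bounded energy controls the distance to
    \<open>ps\<close>.\<close>
  have c: "c1 > 0" "c2 > 0" using delta delta_gamma by (auto simp: c1_def c2_def)
  have le: "c1 * (norm (p t - ps))\<^sup>2 \<le> C \<and> c2 * (norm (l t - ls))\<^sup>2 \<le> C" if t: "t \<ge> t0" for t
    using C[OF t] energy_terms_nonneg[OF t]
      inner_ge_zero[of "(1 / \<delta>) *\<^sub>R (p t - ps) + p' t"]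
    unfolding energy_def distrib_left[of "\<beta> t"] power2_norm_eq_inner c1_def c2_def
    by linarith
  have "norm (p t) \<le> norm ps + sqrt (C / c1) + norm ls + sqrt (C / c2) \<and>
      norm (l t) \<le> norm ps + sqrt (C / c1) + norm ls + sqrt (C / c2)" if t: "t \<ge> t0" for t
  proof -
    have "norm (p t - ps) \<le> sqrt (C / c1)" "norm (l t - ls) \<le> sqrt (C / c2)"
      using le[OF t] c by (auto intro!: real_le_rsqrt simp: field_simps)
    moreover have "norm (p t) \<le> norm ps + norm (p t - ps)" "norm (l t) \<le> norm ls + norm (l t - ls)"
      by norm+
    moreover have "0 \<le> norm (p t - ps)" "0 \<le> norm (l t - ls)" "0 \<le> norm ps" "0 \<le> norm ls"
      by auto
    ultimately show ?thesis by linarith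
  qed
  then show ?thesis by blast
qed

lemma gap_bound: "\<exists>C. \<forall>t\<ge>t0. gap (p t) \<le> C / \<beta> t"
proof -
  obtain C where C: "\<And>t. t \<ge> t0 \<Longrightarrow> energy t \<le> C" using energy_bounded by blast
  have "\<beta> t * gap (p t) \<le> C" if t: "t \<ge> t0" for t
    using C[OF t] energy_terms_nonneg[OF t]
      inner_ge_zero[of "(1 / \<delta>) *\<^sub>R (p t - ps) + p' t"]
    unfolding energy_def distrib_left[of "\<beta> t"] by linarith
  then show ?thesis
    using beta_pos by (intro exI[of _ C]) (auto simp: field_simps)
qed

lemma gap_bigo: "(\<lambda>t. gap (p t)) \<in> O(\<lambda>t. 1 / \<beta> t)"
proof -
  obtain C where C: "\<And>t. t \<ge> t0 \<Longrightarrow> gap (p t) \<le> C / \<beta> t" using gap_bound by blast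
  have "eventually (\<lambda>t. norm (gap (p t)) \<le> C * norm (1 / \<beta> t)) at_top"
    using eventually_ge_at_top[of t0]
    by eventually_elim (use C gap_nonneg beta_pos in \<open>simp add: less_imp_le\<close>)
  then show ?thesis by (rule bigoI)
qed

text \<open>Taking roots in \<open>gap_bound\<close> halves the order of decay. It serves the
  residual with \<open>M = 2\<close> and the gradient difference with
  \<open>M = 2 * L\<close>.\<close>

lemma bigo_sqrt_of_square_le_gap:
  fixes k :: "real \<Rightarrow> real"
  assumes "\<And>t. (k t)\<^sup>2 \<le> M * gap (p t)" and "M \<ge> 0"
  shows "k \<in> O(\<lambda>t. 1 / sqrt (\<beta> t))"
proof -
  obtain C where C: "\<And>t. t \<ge> t0 \<Longrightarrow> gap (p t) \<le> C / \<beta> t" using gap_bound by blast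
  have "norm (k t) \<le> sqrt (M * C) * norm (1 / sqrt (\<beta> t))" if t: "t \<ge> t0" for t
  proof -
    have "(k t)\<^sup>2 \<le> M * (C / \<beta> t)"
      using assms(1)[of t] mult_left_mono[OF C[OF t] \<open>M \<ge> 0\<close>] by linarith
    then have "sqrt ((k t)\<^sup>2) \<le> sqrt (M * C / \<beta> t)" by (intro real_sqrt_le_mono) simp
    then show ?thesis using beta_pos[OF t] by (simp add: real_sqrt_divide)
  qed
  then show ?thesis
    by (intro bigoI[of _ "sqrt (M * C)"] eventually_mono[OF eventually_ge_at_top[of t0]]) blast
qed

lemma residual_bigo: "(\<lambda>t. norm (K (p t) - b)) \<in> O(\<lambda>t. 1 / sqrt (\<beta> t))"
  by (rule bigo_sqrt_of_square_le_gap[OF residual_le_gap]) simp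

lemma grad_diff_bigo: "(\<lambda>t. norm (G (p t) - G ps)) \<in> O(\<lambda>t. 1 / sqrt (\<beta> t))"
  by (rule bigo_sqrt_of_square_le_gap[OF grad_diff_le_gap]) (use L in simp)

text \<open>The gap decays like 1 / \<beta>, but the multiplier term in
  \<open>objective_diff_le_gap\<close> is bounded only at the rate of the residual, which sets the
  rate here.\<close>

lemma objective_bigo: "(\<lambda>t. \<bar>\<Phi> (p t) - \<Phi> ps\<bar>) \<in> O(\<lambda>t. 1 / sqrt (\<beta> t))"
proof -
  \<comment> \<open>One of the two factors \<open>1 / sqrt (\<beta> t)\<close> is frozen at its
    largest value, attained at \<open>t0\<close> because \<beta> is non-decreasing.\<close>
  have "(\<lambda>t. 1 / \<beta> t) \<in> O(\<lambda>t. 1 / sqrt (\<beta> t))"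
  proof (intro bigoI[of _ "1 / sqrt (\<beta> t0)"] eventually_mono[OF eventually_ge_at_top[of t0]])
    fix t assume t: "t0 \<le> t"
    have "sqrt (\<beta> t0) \<le> sqrt (\<beta> t)" using monotone_onD[OF beta_mono, of t0 t] t by simp
    then have "1 / sqrt (\<beta> t) * (1 / sqrt (\<beta> t)) \<le> 1 / sqrt (\<beta> t0) * (1 / sqrt (\<beta> t))"
      using beta_pos[of t0] beta_pos[OF t] by (intro mult_right_mono frac_le) auto
    then show "norm (1 / \<beta> t) \<le> 1 / sqrt (\<beta> t0) * norm (1 / sqrt (\<beta> t))"
      using beta_pos[OF t] by simp
  qed
  then have "(\<lambda>t. gap (p t)) \<in> O(\<lambda>t. 1 / sqrt (\<beta> t))"
    using gap_bigo landau_o.big_trans by blast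
  then have "(\<lambda>t. gap (p t) + norm ls * norm (K (p t) - b)) \<in> O(\<lambda>t. 1 / sqrt (\<beta> t))"
    using residual_bigo by (cases "ls = 0") (auto intro!: sum_in_bigo)
  moreover have "(\<lambda>t. \<bar>\<Phi> (p t) - \<Phi> ps\<bar>) \<in> O(\<lambda>t. gap (p t) + norm ls * norm (K (p t) - b))"
    by (rule bigoI[of _ 1]) (use objective_diff_le_gap gap_nonneg in simp)
  ultimately show ?thesis using landau_o.big_trans by blast
qed

section \<open>Integrability of the dissipated quantities\<close>

lemma
  shows velocity_integrable:
      "set_integrable lborel {t0..} (\<lambda>t. (\<gamma> - 1 / \<delta>) * (norm (p' t))\<^sup>2)"
    and gap_integrable: "set_integrable lborel {t0..} (\<lambda>t. (\<beta> t / \<delta> - \<beta>' t) * gap (p t))"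
    and distance_integrable:
      "set_integrable lborel {t0..} (\<lambda>t. \<beta> t * \<epsilon> t / (2 * \<delta>) * (norm (p t - ps))\<^sup>2)"
    and residual_integrable: "set_integrable lborel {t0..} (\<lambda>t. \<beta> t * (norm (K (p t) - b))\<^sup>2)"
proof -
  \<comment> \<open>Each term is continuous, nonnegative and at most the sum
    \<open>dissipation_rate\<close>, so comparison applies; the residual term is finally rescaled by
    \<open>2 * \<delta>\<close>.\<close>
  have dom: "set_integrable lborel {t0..} k"
    if "continuous_on {t0..} k" "\<And>t. t \<ge> t0 \<Longrightarrow> 0 \<le> k t" "\<And>t. t \<ge> t0 \<Longrightarrow> k t \<le> dissipation_rate t"
    for k
    using set_integrable_atLeast_dominated[OF dissipation_rate_integrable that] .
  note nn = dissipation_terms_nonneg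
  show "set_integrable lborel {t0..} (\<lambda>t. (\<gamma> - 1 / \<delta>) * (norm (p' t))\<^sup>2)"
    by (rule dom) (use nn dissipation_rate_def in \<open>auto intro!: continuous_intros\<close>)
  show "set_integrable lborel {t0..} (\<lambda>t. (\<beta> t / \<delta> - \<beta>' t) * gap (p t))"
    by (rule dom) (use nn dissipation_rate_def delta in \<open>auto intro!: continuous_intros\<close>)
  show "set_integrable lborel {t0..} (\<lambda>t. \<beta> t * \<epsilon> t / (2 * \<delta>) * (norm (p t - ps))\<^sup>2)"
    by (rule dom) (use nn dissipation_rate_def delta in \<open>auto intro!: continuous_intros\<close>)
  have "set_integrable lborel {t0..} (\<lambda>t. \<beta> t / (2 * \<delta>) * (norm (K (p t) - b))\<^sup>2)"
    by (rule dom) (use nn dissipation_rate_def delta in \<open>auto intro!: continuous_intros\<close>)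
  then have "set_integrable lborel {t0..} (\<lambda>t. 2 * \<delta> * (\<beta> t / (2 * \<delta>) * (norm (K (p t) - b))\<^sup>2))"
    by (rule set_integrable_mult_right)
  then show "set_integrable lborel {t0..} (\<lambda>t. \<beta> t * (norm (K (p t) - b))\<^sup>2)"
    using delta by simp
qed

end

subsection \<open>Reduction of the two-block system\<close>

text \<open>The product carries the Euclidean metric, so a common constant for both components
  factors out of the square root; hence the maximum and not the sum.\<close>

lemma lipschitz_on_prod:
  assumes "M1-lipschitz_on UNIV F1" and "M2-lipschitz_on UNIV F2"
  shows "(max M1 M2)-lipschitz_on UNIV (\<lambda>q. (F1 (fst q), F2 (snd q)))"
proof (rule lipschitz_onI)
  let ?M = "max M1 M2"
  show M: "0 \<le> ?M" using lipschitz_on_nonneg[OF assms(1)] by simp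
  fix q r :: "'a \<times> 'c"
  have "dist (F1 (fst q)) (F1 (fst r)) \<le> ?M * dist (fst q) (fst r)"
    using lipschitz_onD[OF assms(1), of "fst q" "fst r"]
      mult_right_mono[of M1 ?M "dist (fst q) (fst r)"] by simp
  moreover have "dist (F2 (snd q)) (F2 (snd r)) \<le> ?M * dist (snd q) (snd r)"
    using lipschitz_onD[OF assms(2), of "snd q" "snd r"]
      mult_right_mono[of M2 ?M "dist (snd q) (snd r)"] by simp
  ultimately have "dist (F1 (fst q), F2 (snd q)) (F1 (fst r), F2 (snd r))
      \<le> sqrt ((?M * dist (fst q) (fst r))\<^sup>2 + (?M * dist (snd q) (snd r))\<^sup>2)"
    unfolding dist_Pair_Pair by (intro real_sqrt_le_mono add_mono power_mono) auto
  also have "\<dots> = ?M * dist q r"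
    using M by (simp add: dist_prod_def power_mult_distrib distrib_left[symmetric] real_sqrt_mult)
  finally show "dist (F1 (fst q), F2 (snd q)) (F1 (fst r), F2 (snd r)) \<le> ?M * dist q r" .
qed

lemma convex_on_prod_sum:
  assumes "convex_on UNIV f" and "convex_on UNIV g"
  shows "convex_on UNIV (\<lambda>q. f (fst q) + g (snd q))"
proof (rule convex_onI)
  fix t :: real and q r :: "'a \<times> 'b" assume "0 < t" "t < 1"
  then show "f (fst ((1 - t) *\<^sub>R q + t *\<^sub>R r)) + g (snd ((1 - t) *\<^sub>R q + t *\<^sub>R r))
      \<le> (1 - t) * (f (fst q) + g (snd q)) + t * (f (fst r) + g (snd r))"
    using convex_onD[OF assms(1), of t "fst q" "fst r"] convex_onD[OF assms(2), of t "snd q" "snd r"]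
    by (simp add: distrib_left)
qed simp

lemma GDERIV_prod_sum:
  assumes "\<And>u. GDERIV f u :> F u" and "\<And>v. GDERIV g v :> H v"
  shows "GDERIV (\<lambda>q. f (fst q) + g (snd q)) q :> (F (fst q), H (snd q))"
proof -
  have "((\<lambda>q. f (fst q)) has_derivative (\<lambda>h. fst h \<bullet> F (fst q))) (at q)"
    by (rule has_derivative_compose[OF has_derivative_fst[OF has_derivative_ident]
        assms(1)[unfolded gderiv_def]])
  moreover have "((\<lambda>q. g (snd q)) has_derivative (\<lambda>h. snd h \<bullet> H (snd q))) (at q)"
    by (rule has_derivative_compose[OF has_derivative_snd[OF has_derivative_ident]
        assms(2)[unfolded gderiv_def]])
  ultimately show ?thesis
    unfolding gderiv_def by (auto dest: has_derivative_add simp: inner_prod_def)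
qed

text \<open>Shifting the multiplier by the residual raises the Lagrangian by the squared residual,
  which maximality in the multiplier forbids unless it is zero.\<close>

lemma saddle_points_feasible:
  assumes "(xs, ys, ls) \<in> saddle_points f g A B b"
  shows "A xs + B ys = b"
proof -
  let ?r = "A xs + B ys - b"
  have "aug_lagrangian f g A B b xs ys (ls + ?r) \<le> aug_lagrangian f g A B b xs ys ls"
    using assms by (simp add: saddle_points_def)
  then have "?r \<bullet> ?r \<le> 0" by (simp add: aug_lagrangian_def inner_add_left)
  then have "?r = 0" by (metis inner_eq_zero_iff inner_ge_zero order_antisym)
  then show ?thesis by simp
qed

theorem theorem4p1:
  fixes A :: "'x::{real_inner, complete_space} \<Rightarrow> 'z::{real_inner, complete_space}"
    and B :: "'y::{real_inner, complete_space} \<Rightarrow> 'z"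
    and b :: 'z
    and f :: "'x \<Rightarrow> real" and gradf :: "'x \<Rightarrow> 'x"
    and g :: "'y \<Rightarrow> real" and gradg :: "'y \<Rightarrow> 'y"
    and l1 l2 t0 \<gamma> \<delta> :: real
    and \<beta> \<beta>' \<epsilon> \<epsilon>' :: "real \<Rightarrow> real"
    and x x' x'' :: "real \<Rightarrow> 'x"
    and y y' y'' :: "real \<Rightarrow> 'y"
    and l l' :: "real \<Rightarrow> 'z"
  assumes A: "bounded_linear A" and B: "bounded_linear B"
    and f_convex: "convex_on UNIV f" and g_convex: "convex_on UNIV g"
    and f_grad: "\<And>u. GDERIV f u :> gradf u" and f_C1: "continuous_on UNIV gradf"
    and g_grad: "\<And>v. GDERIV g v :> gradg v" and g_C1: "continuous_on UNIV gradg"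
    and l1: "l1 > 0" and f_lipschitz: "l1-lipschitz_on UNIV gradf"
    and l2: "l2 > 0" and g_lipschitz: "l2-lipschitz_on UNIV gradg"
    and saddle_nonempty: "saddle_points f g A B b \<noteq> {}"
    and t0: "t0 > 0" and gamma: "\<gamma> > 0" and delta: "\<delta> > 0"
    and beta_pos: "\<And>t. t \<ge> t0 \<Longrightarrow> \<beta> t > 0"
    and beta_mono: "mono_on {t0..} \<beta>"
    and beta_deriv: "\<And>t. t \<ge> t0 \<Longrightarrow> (\<beta> has_real_derivative \<beta>' t) (at t within {t0..})"
    and beta_C1: "continuous_on {t0..} \<beta>'"
    and eps_nonneg: "\<And>t. t \<ge> t0 \<Longrightarrow> \<epsilon> t \<ge> 0"
    and eps_antimono: "antimono_on {t0..} \<epsilon>"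
    and eps_deriv: "\<And>t. t \<ge> t0 \<Longrightarrow> (\<epsilon> has_real_derivative \<epsilon>' t) (at t within {t0..})"
    and eps_C1: "continuous_on {t0..} \<epsilon>'"
    and eps_lim: "(\<epsilon> \<longlongrightarrow> 0) at_top"
    and beta_eps_int: "set_integrable lborel {t0..} (\<lambda>t. \<beta> t * \<epsilon> t)"
    and beta_growth: "\<And>t. t \<ge> t0 \<Longrightarrow> \<beta>' t \<le> 1 / \<delta> * \<beta> t"
    and delta_gamma: "1 / \<delta> < \<gamma>"
    and x_deriv: "\<And>t. t \<ge> t0 \<Longrightarrow> (x has_vector_derivative x' t) (at t within {t0..})"
    and x_deriv2: "\<And>t. t \<ge> t0 \<Longrightarrow> (x' has_vector_derivative x'' t) (at t within {t0..})"
    and y_deriv: "\<And>t. t \<ge> t0 \<Longrightarrow> (y has_vector_derivative y' t) (at t within {t0..})"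
    and y_deriv2: "\<And>t. t \<ge> t0 \<Longrightarrow> (y' has_vector_derivative y'' t) (at t within {t0..})"
    and l_deriv: "\<And>t. t \<ge> t0 \<Longrightarrow> (l has_vector_derivative l' t) (at t within {t0..})"
    and DS_x: "\<And>t. t \<ge> t0 \<Longrightarrow>
        x'' t + \<gamma> *\<^sub>R x' t
        + \<beta> t *\<^sub>R (gradf (x t) + adjoint A (l t) + adjoint A (A (x t) + B (y t) - b)
                  + \<epsilon> t *\<^sub>R x t) = 0"
    and DS_y: "\<And>t. t \<ge> t0 \<Longrightarrow>
        y'' t + \<gamma> *\<^sub>R y' t
        + \<beta> t *\<^sub>R (gradg (y t) + adjoint B (l t) + adjoint B (A (x t) + B (y t) - b)
                  + \<epsilon> t *\<^sub>R y t) = 0"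
    and DS_l: "\<And>t. t \<ge> t0 \<Longrightarrow>
        l' t - \<beta> t *\<^sub>R (A (x t + \<delta> *\<^sub>R x' t) + B (y t + \<delta> *\<^sub>R y' t) - b) = 0"
  shows "\<forall>(xs, ys, ls) \<in> saddle_points f g A B b.
      bounded ((\<lambda>t. (x t, y t, l t)) ` {t0..})
    \<and> (\<lambda>t. aug_lagrangian f g A B b (x t) (y t) ls - aug_lagrangian f g A B b xs ys ls)
        \<in> O(\<lambda>t. 1 / \<beta> t)
    \<and> (\<lambda>t. \<bar>objective f g (x t) (y t) - objective f g xs ys\<bar>) \<in> O(\<lambda>t. 1 / sqrt (\<beta> t))
    \<and> (\<lambda>t. norm (A (x t) + B (y t) - b)) \<in> O(\<lambda>t. 1 / sqrt (\<beta> t))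
    \<and> (\<lambda>t. norm (gradf (x t) - gradf xs)) \<in> O(\<lambda>t. 1 / sqrt (\<beta> t))
    \<and> (\<lambda>t. norm (gradg (y t) - gradg ys)) \<in> O(\<lambda>t. 1 / sqrt (\<beta> t))
    \<and> set_integrable lborel {t0..}
        (\<lambda>t. (\<delta> * \<gamma> - 1) / \<delta> * ((norm (x' t))\<^sup>2 + (norm (y' t))\<^sup>2))
    \<and> set_integrable lborel {t0..}
        (\<lambda>t. (\<beta> t / \<delta> - \<beta>' t) *
          (aug_lagrangian f g A B b (x t) (y t) ls - aug_lagrangian f g A B b xs ys ls))
    \<and> set_integrable lborel {t0..}
        (\<lambda>t. \<beta> t * \<epsilon> t / (2 * \<delta>) * ((norm (x t - xs))\<^sup>2 + (norm (y t - ys))\<^sup>2))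
    \<and> set_integrable lborel {t0..} (\<lambda>t. \<beta> t * (norm (A (x t) + B (y t) - b))\<^sup>2)"
proof (rule ballI)
  fix s assume "s \<in> saddle_points f g A B b"
  moreover obtain xs ys ls where s: "s = (xs, ys, ls)" by (cases s)
  ultimately have saddle: "(xs, ys, ls) \<in> saddle_points f g A B b" by simp
  have feasible: "A xs + B ys = b" by (rule saddle_points_feasible[OF saddle])
  have minimal: "aug_lagrangian f g A B b xs ys ls \<le> aug_lagrangian f g A B b u v ls" for u v
    using saddle by (simp add: saddle_points_def)
  interpret A: bounded_linear A by (rule A)
  interpret B: bounded_linear B by (rule B)
  let ?K = "\<lambda>q. A (fst q) + B (snd q)"
  let ?S = "\<lambda>w. (adjoint A w, adjoint B w)"
  let ?\<Phi> = "\<lambda>q. f (fst q) + g (snd q)"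
  let ?G = "\<lambda>q. (gradf (fst q), gradg (snd q))"
  let ?p = "\<lambda>t. (x t, y t)"
  interpret flow: primal_dual_flow ?K ?S b ?\<Phi> ?G "max l1 l2" t0 \<gamma> \<delta> \<beta> \<beta>' \<epsilon> \<epsilon>'
    ?p "\<lambda>t. (x' t, y' t)" "\<lambda>t. (x'' t, y'' t)" l l' "(xs, ys)" ls
  proof (rule primal_dual_flow.intro)
    show "bounded_linear ?K"
      by (intro bounded_linear_add bounded_linear_compose[OF A] bounded_linear_compose[OF B]
          bounded_linear_fst bounded_linear_snd)
    show "?K u \<bullet> w = u \<bullet> ?S w" for u w
      by (simp add: inner_prod_def inner_add_left adjoint_works_Hilbert[OF A]
          adjoint_works_Hilbert[OF B])
    show "convex_on UNIV ?\<Phi>" by (rule convex_on_prod_sum[OF f_convex g_convex])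
    show "GDERIV ?\<Phi> u :> ?G u" for u by (rule GDERIV_prod_sum[OF f_grad g_grad])
    show "0 < max l1 l2" using l1 by simp
    show "(max l1 l2)-lipschitz_on UNIV ?G" by (rule lipschitz_on_prod[OF f_lipschitz g_lipschitz])
    show "(?p has_vector_derivative (x' t, y' t)) (at t within {t0..})" if "t0 \<le> t" for t
      by (rule has_vector_derivative_Pair[OF x_deriv[OF that] y_deriv[OF that]])
    show "((\<lambda>t. (x' t, y' t)) has_vector_derivative (x'' t, y'' t)) (at t within {t0..})"
      if "t0 \<le> t" for t
      by (rule has_vector_derivative_Pair[OF x_deriv2[OF that] y_deriv2[OF that]])
    show "(x'' t, y'' t) + \<gamma> *\<^sub>R (x' t, y' t)
        + \<beta> t *\<^sub>R (?G (?p t) + ?S (l t) + ?S (?K (?p t) - b) + \<epsilon> t *\<^sub>R ?p t) = 0"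
      if "t0 \<le> t" for t
      using DS_x[OF that] DS_y[OF that] by (simp add: zero_prod_def)
    show "l' t = \<beta> t *\<^sub>R (?K (?p t + \<delta> *\<^sub>R (x' t, y' t)) - b)" if "t0 \<le> t" for t
      using DS_l[OF that] by simp
    show "?K (xs, ys) = b" using feasible by simp
    show "?\<Phi> (xs, ys) \<le> ?\<Phi> q + ls \<bullet> (?K q - b) + 1 / 2 * (norm (?K q - b))\<^sup>2" for q
      using minimal[of "fst q" "snd q"] feasible by (simp add: aug_lagrangian_def)
  qed (fact delta delta_gamma beta_pos beta_mono beta_deriv beta_C1 beta_growth eps_nonneg
      eps_antimono eps_deriv beta_eps_int l_deriv)+
  have gap: "flow.gap (u, v)
      = aug_lagrangian f g A B b u v ls - aug_lagrangian f g A B b xs ys ls" for u v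
    by (simp add: flow.gap_def aug_lagrangian_def feasible)
  \<comment> \<open>Product norms split into sums of squares, which gives the integrals of part (ii)
    their two-block form.\<close>
  have norm_Pair: "(norm (u, v))\<^sup>2 = (norm u)\<^sup>2 + (norm v)\<^sup>2" for u :: 'x and v :: 'y
    by (simp add: norm_prod_def)
  have coeff: "(\<delta> * \<gamma> - 1) / \<delta> = \<gamma> - 1 / \<delta>"
    using delta by (simp add: diff_divide_distrib)
  obtain C where C: "\<And>t. t \<ge> t0 \<Longrightarrow> norm (?p t) \<le> C \<and> norm (l t) \<le> C"
    using flow.trajectory_bounded by blast
  have bdd: "bounded ((\<lambda>t. (x t, y t, l t)) ` {t0..})"
  proof (rule boundedI)
    fix q assume "q \<in> (\<lambda>t. (x t, y t, l t)) ` {t0..}"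
    then obtain t where t: "t \<ge> t0" and q: "q = (x t, y t, l t)" by auto
    have "norm (x t) \<le> C" "norm (y t) \<le> C" "norm (l t) \<le> C"
      using C[OF t] norm_fst_le[of "x t" "y t"] norm_snd_le[of "y t" "x t"] by linarith+
    then show "norm q \<le> C + (C + C)"
      unfolding q by (meson add_mono norm_Pair_le order_trans)
  qed
  \<comment> \<open>Each component is bounded by the norm of the pair, so the rate for
    \<open>?G\<close> yields both gradient rates.\<close>
  have grads: "(\<lambda>t. norm (gradf (x t) - gradf xs)) \<in> O(\<lambda>t. 1 / sqrt (\<beta> t))"
    "(\<lambda>t. norm (gradg (y t) - gradg ys)) \<in> O(\<lambda>t. 1 / sqrt (\<beta> t))"
    by (rule landau_o.big_trans[OF bigoI[of _ 1] flow.grad_diff_bigo];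
        simp add: norm_fst_le norm_snd_le)+
  show "case s of (xs, ys, ls) \<Rightarrow> bounded ((\<lambda>t. (x t, y t, l t)) ` {t0..})
    \<and> (\<lambda>t. aug_lagrangian f g A B b (x t) (y t) ls - aug_lagrangian f g A B b xs ys ls)
        \<in> O(\<lambda>t. 1 / \<beta> t)
    \<and> (\<lambda>t. \<bar>objective f g (x t) (y t) - objective f g xs ys\<bar>) \<in> O(\<lambda>t. 1 / sqrt (\<beta> t))
    \<and> (\<lambda>t. norm (A (x t) + B (y t) - b)) \<in> O(\<lambda>t. 1 / sqrt (\<beta> t))
    \<and> (\<lambda>t. norm (gradf (x t) - gradf xs)) \<in> O(\<lambda>t. 1 / sqrt (\<beta> t))
    \<and> (\<lambda>t. norm (gradg (y t) - gradg ys)) \<in> O(\<lambda>t. 1 / sqrt (\<beta> t))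
    \<and> set_integrable lborel {t0..}
        (\<lambda>t. (\<delta> * \<gamma> - 1) / \<delta> * ((norm (x' t))\<^sup>2 + (norm (y' t))\<^sup>2))
    \<and> set_integrable lborel {t0..}
        (\<lambda>t. (\<beta> t / \<delta> - \<beta>' t) *
          (aug_lagrangian f g A B b (x t) (y t) ls - aug_lagrangian f g A B b xs ys ls))
    \<and> set_integrable lborel {t0..}
        (\<lambda>t. \<beta> t * \<epsilon> t / (2 * \<delta>) * ((norm (x t - xs))\<^sup>2 + (norm (y t - ys))\<^sup>2))
    \<and> set_integrable lborel {t0..} (\<lambda>t. \<beta> t * (norm (A (x t) + B (y t) - b))\<^sup>2)"
    unfolding s prod.case
    using bdd flow.gap_bigo flow.objective_bigo flow.residual_bigo grads flow.velocity_integrable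
      flow.gap_integrable flow.distance_integrable flow.residual_integrable
    unfolding gap coeff norm_Pair diff_Pair fst_conv snd_conv objective_def
    by (intro conjI)
qed

end
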